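(* Let $I$ be an index set with cardinality at most that of the continuum and let $\{\mu_\alpha\}_{\alpha\in I}$ be a collection of probability measures on $\mathbb{R}$. Then there exist probability spaces $\{(\Omega_\alpha,\mathcal{F}_\alpha,\mathbb{P}_\alpha)\}_{\alpha\in I}$, a family $\{X_\alpha\}_{\alpha\in I}$ of uniformly distributed random variables $X_\alpha:\Omega_\alpha\to[0,1]$, and a single function $h:[0,1]\to\mathbb{R}$ (not depending on $\alpha$) such that, for all $\alpha\in I$, $h(X_\alpha)=h\circ X_\alpha$ is measurable and has law $\mu_\alpha$.
   Context: $\mathcal{B}[0,1]$ denotes the Borel $\sigma$-algebra on $[0,1]$ and $\lambda$ denotes Lebesgue measure on $[0,1]$ restricted to Borel sets. A random variable $X:\Omega\to[0,1]$ on a probability space $(\Omega,\mathcal{F},\mathbb{P})$, i.e. a function measurable from $\mathcal{F}$ to $\mathcal{B}[0,1]$, is called uniformly distributed if $\mathbb{P}(X^{-1}(A))=\lambda(A)$ for all $A\in\mathcal{B}[0,1]$. Random variables may be defined on different probability spaces. Probability measures on $\mathbb{R}$ are Borel probability measures. The function $h$ is an arbitrary function (not required to be Borel or Lebesgue measurable); measurability of $h(X_\alpha)$ means that $h\circ X_\alpha:\Omega_\alpha\to\mathbb{R}$ is measurable from $\mathcal{F}_\alpha$ to the Borel $\sigma$-algebra of $\mathbb{R}$. *)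

theory Defs
  imports "HOL-Probability.Probability" "HOL-Library.Equipollence"
begin

definition uniformly_distributed :: "'w measure \<Rightarrow> ('w \<Rightarrow> real) \<Rightarrow> bool" where
  "uniformly_distributed M X \<longleftrightarrow>
     X \<in> M \<rightarrow>\<^sub>M restrict_space borel {0..1} \<and>
     (\<forall>A \<in> sets (restrict_space borel {0..1}).
        emeasure M (X -` A \<inter> space M) = emeasure lborel A)"

end

theory Submission imports Defs begin

text \<open>
  The idea is to split the unit interval into disjoint pieces, one for each index \<open>\<alpha>\<close>, each of
  which supports a uniform random variable, and to let \<open>h\<close> be the quantile function of \<open>\<mu> \<alpha>\<close> on
  the piece that belongs to \<open>\<alpha>\<close>. Two disjoint measurable sets cannot both have
  full measure, but it suffices that each piece has full outer measure.

  A Bernstein-type construction gives disjoint sets \<open>A \<alpha> \<subseteq> {0<..<1}\<close> that meet every compact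
  set \<open>K \<subseteq> {0<..<1}\<close> of positive measure: there are at most continuum many pairs \<open>(K, \<alpha>)\<close>, every
  such \<open>K\<close> has continuum many points (lemma \<open>real_lepoll_compact_pos_measure\<close>), so distinct
  points \<open>f (K, \<alpha>) \<in> K\<close> can be chosen by transfinite recursion (lemma
  \<open>distinct_representatives\<close>), and \<open>A \<alpha>\<close> consists of the points \<open>f (K, \<alpha>)\<close>. By inner regularity,
  a Borel subset of \<open>{0<..<1}\<close> that misses \<open>A \<alpha>\<close> is null.

  Lebesgue measure therefore has a trace on \<open>A \<alpha>\<close>, given by \<open>B \<inter> A \<alpha> \<mapsto> \<lambda>(B)\<close> for Borel
  \<open>B \<subseteq> {0<..<1}\<close>, under which every measurable function on \<open>{0<..<1}\<close> keeps its law. With this trace as the probability measure on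
  \<open>A \<alpha>\<close>, the inclusion \<open>X \<alpha>\<close> is uniformly distributed, and \<open>h \<circ> X \<alpha>\<close> is the restriction of the
  quantile function of \<open>\<mu> \<alpha>\<close>, so its law is \<open>\<mu> \<alpha>\<close>.
\<close>

section \<open>Cardinality\<close>

text \<open>
  Well-order \<open>T\<close> in its cardinal order type. Each proper initial segment is then smaller than \<open>T\<close>,
  hence than every \<open>S t\<close>, so there is always a point of \<open>S t\<close> that was not chosen earlier.
\<close>

lemma distinct_representatives:
  includes cardinal_syntax
  fixes S :: "'a \<Rightarrow> 'b set"
  assumes "\<And>t. t \<in> T \<Longrightarrow> T \<lesssim> S t"
  obtains f where "inj_on f T" "\<And>t. t \<in> T \<Longrightarrow> f t \<in> S t"
proof -
  let ?r = "|T|"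
  have wo: "Well_order ?r" by (rule card_of_Well_order)
  have F: "Field ?r = T" by (rule Field_card_of)
  have co: "Card_order ?r" by (rule card_of_Card_order)
  have wf: "wf (?r - Id)"
    using wo by (simp add: well_order_on_def)
  define P where "P f t y \<longleftrightarrow> (t \<in> T \<longrightarrow> y \<in> S t - f ` underS ?r t)" for f t y
  have "\<exists>f. \<forall>t. P f t (f t)"
  proof (rule dependent_wf_choice[OF wf])
    fix f g :: "'a \<Rightarrow> 'b" and x y
    assume "\<And>z. (z, x) \<in> ?r - Id \<Longrightarrow> f z = g z"
    then have "f ` underS ?r x = g ` underS ?r x"
      by (auto simp: underS_def image_iff)
    then show "P f x y = P g x y"
      by (simp add: P_def)
  next
    fix f :: "'a \<Rightarrow> 'b" and t
    show "\<exists>y. P f t y"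
    proof (cases "t \<in> T")
      case True
      have "|f ` underS ?r t| \<le>o |underS ?r t|"
        by (rule card_of_image)
      also have "|underS ?r t| <o ?r"
        using True F by (intro card_of_underS co) simp
      also have "?r \<le>o |S t|"
        using assms[OF True] unfolding lepoll_def card_of_ordLeq .
      finally have "\<not> |S t| \<le>o |f ` underS ?r t|"
        by (meson not_ordLess_ordLeq)
      then have "\<not> S t \<subseteq> f ` underS ?r t"
        using card_of_mono1 by blast
      then show ?thesis by (auto simp: P_def)
    qed (simp add: P_def)
  qed
  then obtain f where f: "\<And>t. P f t (f t)" by blast
  show thesis
  proof
    show "f t \<in> S t" if "t \<in> T" for t
      using f[of t] that by (simp add: P_def)
    have neq: "f s \<noteq> f t" if "s \<in> underS ?r t" "t \<in> T" for s t
      using f[of t] that by (metis DiffD2 P_def imageI)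
    have "s \<in> underS ?r t \<or> t \<in> underS ?r s" if "s \<in> T" "t \<in> T" "s \<noteq> t" for s t
      using wo that F by (auto simp: order_on_defs total_on_def underS_def)
    then show "inj_on f T"
      by (intro inj_onI) (metis neq)
  qed
qed

text \<open>
  A closed set is determined by the members of a countable basis that are disjoint from it.
\<close>

lemma closed_sets_lepoll_real:
  "{C :: 'a :: second_countable_topology set. closed C} \<lesssim> (UNIV :: real set)"
proof -
  obtain B :: "'a set set" where B: "countable B" "topological_basis B"
    using ex_countable_basis by blast
  define F where "F C = to_nat_on B ` {b \<in> B. b \<subseteq> - C}" for C
  have "inj_on F {C. closed C}"
  proof (rule inj_onI; simp)
    fix C D assume CD: "closed C" "closed D" "F C = F D"
    have eq: "\<Union>{b \<in> B. b \<subseteq> - E} = - E" if "closed E" for E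
    proof
      show "- E \<subseteq> \<Union>{b \<in> B. b \<subseteq> - E}"
        using topological_basisE[OF B(2) open_Compl[OF that]] by blast
    qed blast
    have "{b \<in> B. b \<subseteq> - C} = {b \<in> B. b \<subseteq> - D}"
      using CD(3) inj_on_image_eq_iff[OF inj_on_to_nat_on[OF B(1)],
          of "{b \<in> B. b \<subseteq> - C}" "{b \<in> B. b \<subseteq> - D}"]
      unfolding F_def by blast
    from arg_cong[OF this, of Union] have "- C = - D"
      by (simp only: eq[OF CD(1)] eq[OF CD(2)])
    then show "C = D" by simp
  qed
  then have "{C :: 'a set. closed C} \<lesssim> (UNIV :: nat set set)"
    unfolding lepoll_def by blast
  then show ?thesis
    using nat_sets_eqpoll_reals lepoll_trans2 by blast
qed

text \<open>
  The distribution function \<open>x \<mapsto> \<lambda>(K \<inter> {..x})\<close> is continuous and maps \<open>K\<close> onto a set containing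
  the open interval from \<open>0\<close> to \<open>\<lambda>(K)\<close>.
\<close>

lemma real_lepoll_compact_pos_measure:
  fixes K :: "real set"
  assumes "compact K" "measure lborel K > 0"
  shows "(UNIV :: real set) \<lesssim> K"
proof -
  define F where "F x = measure lborel (K \<inter> {..x})" for x
  have [measurable]: "K \<in> sets borel"
    using assms(1) by (simp add: borel_compact)
  have fm: "K \<inter> A \<in> fmeasurable lborel" if "A \<in> sets borel" for A
    using assms(1) that fmeasurable_Int_fmeasurable[of K lborel A] fmeasurable_compact[of K]
    by auto
  have F: "F a \<le> F b" "F b \<le> F a + (b - a)" if "a \<le> b" for a b
  proof -
    show "F a \<le> F b"
      unfolding F_def using that by (intro measure_mono_fmeasurable fm) auto
    have "F b \<le> measure lborel ((K \<inter> {..a}) \<union> {a..b})"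
      unfolding F_def using that
      by (intro measure_mono_fmeasurable fmeasurable.Un fm) (auto intro: fmeasurableI)
    also have "\<dots> \<le> F a + measure lborel {a..b}"
      unfolding F_def by (intro measure_Un_le) (use fm in \<open>auto\<close>)
    finally show "F b \<le> F a + (b - a)" using that by simp
  qed
  have "dist (F x) (F y) \<le> 1 * dist x y" for x y
    using F[of x y] F[of y x] by (cases "x \<le> y") (auto simp: dist_real_def)
  then have cont: "continuous_on UNIV F"
    by (intro lipschitz_on_continuous_on[of 1]) (auto intro: lipschitz_onI)
  obtain a b where ab: "K \<subseteq> {a..b}"
    using assms(1) compact_imp_bounded bounded_subset_cbox_symmetric by (metis cbox_interval)
  have "{0<..<measure lborel K} \<subseteq> F ` K"
  proof
    fix t assume t: "t \<in> {0<..<measure lborel K}"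
    have "K \<inter> {..a} \<subseteq> {a}" "K \<inter> {..b} = K" using ab by auto
    then have "F a = 0" "F b = measure lborel K"
      using measure_mono_fmeasurable[of "K \<inter> {..a}" "{a}" lborel]
      by (auto simp: F_def fmeasurableI measure_le_0_iff)
    moreover have "K \<noteq> {}" using assms by auto
    then have "a \<le> b" using ab by auto
    ultimately obtain y where y: "F y = t"
      using IVT'[of F a t b] t cont continuous_on_subset by fastforce
    \<comment> \<open>Moving \<open>y\<close> down to the largest point of \<open>K\<close> below it does not change \<open>F\<close>.\<close>
    have "K \<inter> {..y} \<noteq> {}"
      using y t by (auto simp: F_def)
    moreover have "compact (K \<inter> {..y})"
      using assms by (simp add: compact_Int_closed)
    ultimately obtain x where x: "x \<in> K \<inter> {..y}" "\<And>z. z \<in> K \<inter> {..y} \<Longrightarrow> z \<le> x"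
      using compact_attains_sup by metis
    then have "K \<inter> {..x} = K \<inter> {..y}" by force
    then have "F x = t" using y by (simp add: F_def)
    then show "t \<in> F ` K" using x by auto
  qed
  then have "{0<..<measure lborel K} \<lesssim> K"
    by (rule subset_image_lepoll)
  moreover have "(UNIV :: real set) \<approx> {0<..<measure lborel K}"
    by (rule eqpoll_sym) (simp add: open_interval_eqpoll_reals assms(2))
  ultimately show ?thesis
    by (rule lepoll_trans1[rotated])
qed

section \<open>The trace of a measure on a set of full outer measure\<close>

text \<open>
  The trace of \<open>M\<close> on a set \<open>A\<close>, which need not be measurable: the \<open>\<sigma>\<close>-algebra consists of the
  intersections of measurable sets with \<open>A\<close>, and the measure is the outer measure of \<open>M\<close>. For
  nonmeasurable \<open>A\<close> this can differ from \<^const>\<open>restrict_space\<close>, which measures the trace sets by \<open>M\<close>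
  itself.
\<close>

definition trace_measure :: "'a measure \<Rightarrow> 'a set \<Rightarrow> 'a measure" where
  "trace_measure M A = measure_of A {B \<inter> A | B. B \<in> sets M} (outer_measure_of M)"

context
  fixes M :: "'a measure" and A :: "'a set"
  assumes sub: "A \<subseteq> space M"
begin

lemma sigma_algebra_trace: "sigma_algebra A {B \<inter> A | B. B \<in> sets M}"
proof -
  have "{B \<inter> A | B. B \<in> sets M} = sets (vimage_algebra A (\<lambda>x. x) M)"
    using sub by (subst sets_vimage_algebra2) auto
  then show ?thesis
    using sets.sigma_algebra_axioms[of "vimage_algebra A (\<lambda>x. x) M"] by simp
qed

lemma space_trace_measure: "space (trace_measure M A) = A"
  by (simp add: trace_measure_def sigma_algebra.space_measure_of_eq[OF sigma_algebra_trace])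

lemma sets_trace_measure: "sets (trace_measure M A) = {B \<inter> A | B. B \<in> sets M}"
  by (simp add: trace_measure_def sigma_algebra.sets_measure_of_eq[OF sigma_algebra_trace])

lemma measurable_trace_measure:
  assumes "f \<in> M \<rightarrow>\<^sub>M N"
  shows "f \<in> trace_measure M A \<rightarrow>\<^sub>M N"
proof (rule measurableI)
  fix C assume C: "C \<in> sets N"
  have "f -` C \<inter> A = (f -` C \<inter> space M) \<inter> A" using sub by auto
  then show "f -` C \<inter> space (trace_measure M A) \<in> sets (trace_measure M A)"
    using measurable_sets[OF assms C] by (auto simp: sets_trace_measure space_trace_measure)
qed (use assms sub in \<open>auto simp: space_trace_measure dest: measurable_space\<close>)

end

context
  fixes M :: "'a measure" and A :: "'a set"
  assumes sub: "A \<subseteq> space M"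
    \<comment> \<open>\<open>A\<close> has full outer measure.\<close>
    and full: "\<And>B. B \<in> sets M \<Longrightarrow> B \<inter> A = {} \<Longrightarrow> emeasure M B = 0"
begin

text \<open>
  If a measurable \<open>C\<close> contains \<open>B \<inter> A\<close>, then \<open>B - C\<close> misses \<open>A\<close> and is null; so covering
  \<open>B \<inter> A\<close> is no cheaper than covering \<open>B\<close>.
\<close>

lemma outer_measure_of_trace:
  assumes "B \<in> sets M"
  shows "outer_measure_of M (B \<inter> A) = emeasure M B"
proof (rule antisym)
  show "outer_measure_of M (B \<inter> A) \<le> emeasure M B"
    unfolding outer_measure_of_def using assms by (intro INF_lower) auto
  show "emeasure M B \<le> outer_measure_of M (B \<inter> A)"
    unfolding outer_measure_of_def
  proof (rule INF_greatest, safe)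
    fix C assume C: "C \<in> sets M" "B \<inter> A \<subseteq> C"
    have "emeasure M B \<le> emeasure M (C \<union> (B - C))"
      using C assms by (intro emeasure_mono) auto
    also have "\<dots> \<le> emeasure M C + emeasure M (B - C)"
      using C assms by (intro emeasure_subadditive) auto
    also have "emeasure M (B - C) = 0"
      using C assms by (intro full) auto
    finally show "emeasure M B \<le> emeasure M C" by simp
  qed
qed

lemma emeasure_trace_measure:
  assumes "B \<in> sets M"
  shows "emeasure (trace_measure M A) (B \<inter> A) = emeasure M B"
proof -
  have "countably_additive {B \<inter> A | B. B \<in> sets M} (outer_measure_of M)"
  proof (rule countably_additiveI)
    fix E :: "nat \<Rightarrow> 'a set"
    assume "range E \<subseteq> {B \<inter> A | B. B \<in> sets M}" and disj: "disjoint_family E"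
    then have "\<forall>i. \<exists>B. B \<in> sets M \<and> E i = B \<inter> A" by blast
    then obtain B where B: "\<And>i. B i \<in> sets M" "\<And>i. E i = B i \<inter> A" by metis
    \<comment> \<open>The sets \<open>B i\<close> may overlap outside \<open>A\<close>; making them disjoint does not change their traces.\<close>
    define D where "D = disjointed B"
    have D: "D i \<in> sets M" for i
      using sets.range_disjointed_sets[of B M] B(1) unfolding D_def by blast
    have ED: "E i = D i \<inter> A" for i
    proof -
      have "E i \<inter> E j = {}" if "j < i" for j
        using disj that by (auto simp: disjoint_family_on_def)
      then show ?thesis
        unfolding D_def disjointed_def B(2) by fastforce
    qed
    have "(\<Sum>i. outer_measure_of M (E i)) = (\<Sum>i. emeasure M (D i))"
      using D by (simp add: ED outer_measure_of_trace)
    also have "\<dots> = emeasure M (\<Union>i. D i)"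
      using D disjoint_family_disjointed by (intro suminf_emeasure) (auto simp: D_def)
    also have "\<dots> = outer_measure_of M ((\<Union>i. D i) \<inter> A)"
      using D by (intro outer_measure_of_trace[symmetric]) auto
    also have "(\<Union>i. D i) \<inter> A = (\<Union>i. E i)" using ED by auto
    finally show "(\<Sum>i. outer_measure_of M (E i)) = outer_measure_of M (\<Union>i. E i)" .
  qed
  moreover have "positive {B \<inter> A | B. B \<in> sets M} (outer_measure_of M)"
    using outer_measure_of_trace[of "{}"] by (simp add: positive_def)
  ultimately have "emeasure (trace_measure M A) (B \<inter> A) = outer_measure_of M (B \<inter> A)"
    using assms unfolding trace_measure_def
    by (intro emeasure_measure_of_sigma[OF sigma_algebra_trace[OF sub]]) auto
  then show ?thesis using assms by (simp add: outer_measure_of_trace)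
qed

lemma distr_trace_measure:
  assumes "f \<in> M \<rightarrow>\<^sub>M N"
  shows "distr (trace_measure M A) N f = distr M N f"
proof (rule measure_eqI)
  fix C assume C: "C \<in> sets (distr (trace_measure M A) N f)"
  have "f -` C \<inter> A = (f -` C \<inter> space M) \<inter> A" using sub by auto
  then show "emeasure (distr (trace_measure M A) N f) C = emeasure (distr M N f) C"
    using C assms measurable_trace_measure[OF sub assms]
    by (simp add: emeasure_distr space_trace_measure[OF sub] emeasure_trace_measure)
qed simp

lemma prob_space_trace_measure:
  assumes "prob_space M"
  shows "prob_space (trace_measure M A)"
proof (rule prob_spaceI)
  have "A = space M \<inter> A" using sub by auto
  then show "emeasure (trace_measure M A) (space (trace_measure M A)) = 1"
    using emeasure_trace_measure[of "space M"] assms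
    by (simp add: space_trace_measure[OF sub] prob_space.emeasure_space_1)
qed

end

section \<open>Disjoint sets of full outer measure\<close>

lemma compact_pos_measure_subset:
  fixes B :: "real set"
  assumes "B \<in> sets borel" "bounded B" "emeasure lborel B \<noteq> 0"
  obtains K where "compact K" "K \<subseteq> B" "measure lborel K > 0"
proof -
  have fin: "B \<in> fmeasurable lborel"
    using assms emeasure_bounded_finite by (intro fmeasurableI) auto
  then have pos: "measure lborel B > 0"
    using assms(3) by (simp add: emeasure_eq_measure2[OF fin] zero_less_measure_iff)
  have "B \<in> sets lebesgue" using assms(1) by simp
  then obtain T where T: "closed T" "T \<subseteq> B" "B - T \<in> lmeasurable"
      "emeasure lebesgue (B - T) < ennreal (measure lborel B)"
    by (rule sets_lebesgue_inner_closed[OF _ pos])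
  have "compact T"
    using T assms(2) bounded_subset compact_eq_bounded_closed by blast
  moreover have "measure lborel T \<noteq> 0"
  proof
    assume "measure lborel T = 0"
    then have "measure lborel (B - T) = measure lborel B"
      using measurable_measure_Diff[of B lborel T] fin T by auto
    moreover have "emeasure lborel (B - T) < ennreal (measure lborel B)"
      using T assms(1) by (simp add: emeasure_completion)
    moreover have "B - T \<in> fmeasurable lborel"
      using fin T by (auto intro: fmeasurable.Diff fmeasurable_Diff)
    ultimately show False
      by (simp add: emeasure_eq_measure2)
  qed
  ultimately show thesis
    using T that by (metis measure_nonneg order_le_less)
qed

text \<open>
  Full outer measure in \<open>{0<..<1}\<close> is expressed by the last property: every Borel subset of
  \<open>{0<..<1}\<close> that is disjoint from \<open>A i\<close> is null.
\<close>

lemma disjoint_full_outer_measure: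
  assumes "I \<lesssim> (UNIV :: real set)"
  obtains A :: "'i \<Rightarrow> real set" where "disjoint_family_on A I"
    and "\<And>i. i \<in> I \<Longrightarrow> A i \<subseteq> {0<..<1}"
    and "\<And>i B. \<lbrakk>i \<in> I; B \<in> sets borel; B \<subseteq> {0<..<1}; B \<inter> A i = {}\<rbrakk> \<Longrightarrow> emeasure lborel B = 0"
proof -
  define Ks where "Ks = {K. compact K \<and> K \<subseteq> {0<..<1::real} \<and> measure lborel K > 0}"
  have "Ks \<lesssim> {C :: real set. closed C}"
    by (intro subset_imp_lepoll) (auto simp: Ks_def compact_imp_closed)
  then have "Ks \<lesssim> (UNIV :: real set)"
    using closed_sets_lepoll_real lepoll_trans by blast
  then have "Ks \<times> I \<lesssim> (UNIV :: real set) \<times> (UNIV :: real set)"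
    using assms by (rule times_lepoll_mono)
  also have "(UNIV :: real set) \<times> (UNIV :: real set) \<approx> (UNIV :: real set)"
    unfolding eqpoll_iff_card_of_ordIso
    by (intro card_of_Times_same_infinite infinite_UNIV_char_0)
  finally have T: "Ks \<times> I \<lesssim> (UNIV :: real set)" .
  have "Ks \<times> I \<lesssim> fst t" if "t \<in> Ks \<times> I" for t
    using that real_lepoll_compact_pos_measure[of "fst t"] lepoll_trans[OF T] by (auto simp: Ks_def)
  then obtain f where inj: "inj_on f (Ks \<times> I)" and f: "\<And>t. t \<in> Ks \<times> I \<Longrightarrow> f t \<in> fst t"
    using distinct_representatives[of "Ks \<times> I" fst] by metis
  define A where "A i = (\<lambda>K. f (K, i)) ` Ks" for i
  show thesis
  proof
    show "disjoint_family_on A I"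
      using inj by (auto simp: disjoint_family_on_def A_def inj_on_def)
    show "A i \<subseteq> {0<..<1}" if "i \<in> I" for i
      using f that by (fastforce simp: A_def Ks_def)
    show "emeasure lborel B = 0"
      if i: "i \<in> I" and B: "B \<in> sets borel" "B \<subseteq> {0<..<1}" "B \<inter> A i = {}" for i B
    proof (rule ccontr)
      assume "emeasure lborel B \<noteq> 0"
      then obtain K where K: "compact K" "K \<subseteq> B" "measure lborel K > 0"
        using compact_pos_measure_subset B bounded_subset[OF _ B(2)] by (metis bounded_Ioo)
      then have "K \<in> Ks" using B by (auto simp: Ks_def)
      then have "f (K, i) \<in> B \<inter> A i"
        using f[of "(K, i)"] i K by (auto simp: A_def)
      then show False using B by auto
    qed
  qed
qed

section \<open>One function realising all laws\<close>

theorem theorem2: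
  fixes I :: "'i set" and \<mu> :: "'i \<Rightarrow> real measure"
  assumes "I \<lesssim> (UNIV :: real set)"
    and "\<And>\<alpha>. \<alpha> \<in> I \<Longrightarrow> prob_space (\<mu> \<alpha>)"
    and "\<And>\<alpha>. \<alpha> \<in> I \<Longrightarrow> sets (\<mu> \<alpha>) = sets borel"
  shows "\<exists>(P :: 'i \<Rightarrow> real measure) (X :: 'i \<Rightarrow> real \<Rightarrow> real) (h :: real \<Rightarrow> real).
           \<forall>\<alpha>\<in>I. prob_space (P \<alpha>) \<and> uniformly_distributed (P \<alpha>) (X \<alpha>) \<and>
                 h \<circ> X \<alpha> \<in> borel_measurable (P \<alpha>) \<and>
                 distr (P \<alpha>) borel (h \<circ> X \<alpha>) = \<mu> \<alpha>"
proof -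
  let ?U = "restrict_space lborel {0<..<1::real}"
  obtain A :: "'i \<Rightarrow> real set" where disj: "disjoint_family_on A I"
    and A: "\<And>i. i \<in> I \<Longrightarrow> A i \<subseteq> {0<..<1}"
    and null: "\<And>i B. \<lbrakk>i \<in> I; B \<in> sets borel; B \<subseteq> {0<..<1}; B \<inter> A i = {}\<rbrakk>
      \<Longrightarrow> emeasure lborel B = 0"
    by (rule disjoint_full_outer_measure[OF assms(1)]) blast
  have "\<exists>q. q \<in> borel_measurable ?U \<and> distr ?U borel q = \<mu> i" if "i \<in> I" for i
  proof -
    \<comment> \<open>The quantile function of \<open>\<mu> i\<close>.\<close>
    interpret cdf_distribution "\<mu> i"
      unfolding cdf_distribution_def real_distribution_def real_distribution_axioms_def
      using assms(2,3)[OF that] sets_eq_imp_space_eq by auto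
    show ?thesis
      using distr_I_eq_M measurable_CI measurable_cong_sets[OF sets_restrict_space_cong[OF sets_lborel] refl]
      by blast
  qed
  then obtain q where q: "\<And>i. i \<in> I \<Longrightarrow> q i \<in> borel_measurable ?U"
    "\<And>i. i \<in> I \<Longrightarrow> distr ?U borel (q i) = \<mu> i"
    by metis
  define h where "h x = q (THE i. i \<in> I \<and> x \<in> A i) x" for x
  define P where "P i = trace_measure ?U (A i)" for i
  have "prob_space (P i) \<and> uniformly_distributed (P i) (\<lambda>x. x) \<and>
      h \<circ> (\<lambda>x. x) \<in> borel_measurable (P i) \<and> distr (P i) borel (h \<circ> (\<lambda>x. x)) = \<mu> i"
    if i: "i \<in> I" for i
  proof -
    have sub: "A i \<subseteq> space ?U"
      using A[OF i] by (simp add: space_restrict_space)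
    have full: "emeasure ?U B = 0" if "B \<in> sets ?U" "B \<inter> A i = {}" for B
      using null[OF i, of B] that by (auto simp: sets_restrict_space emeasure_restrict_space)
    have h: "h x = q i x" if "x \<in> A i" for x
    proof -
      have "(THE j. j \<in> I \<and> x \<in> A j) = i"
        using disj i that by (intro the_equality) (auto simp: disjoint_family_on_def)
      then show ?thesis by (simp add: h_def)
    qed
    have space: "space (P i) = A i"
      unfolding P_def by (rule space_trace_measure[OF sub])
    have "prob_space ?U"
      by (intro prob_spaceI) (simp add: space_restrict_space emeasure_restrict_space)
    then have "prob_space (P i)"
      unfolding P_def by (intro prob_space_trace_measure sub full)
    moreover have "uniformly_distributed (P i) (\<lambda>x. x)"
      unfolding uniformly_distributed_def
    proof (intro conjI ballI)
      have "(\<lambda>x. x) \<in> ?U \<rightarrow>\<^sub>M restrict_space borel {0..1}"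
        by (intro measurable_restrict_space2 measurable_restrict_space1)
          (auto simp: space_restrict_space)
      then show "(\<lambda>x. x) \<in> P i \<rightarrow>\<^sub>M restrict_space borel {0..1}"
        unfolding P_def by (rule measurable_trace_measure[OF sub])
    next
      fix B :: "real set" assume "B \<in> sets (restrict_space borel {0..1})"
      then have B: "B \<in> sets borel" "B \<subseteq> {0..1}"
        by (auto simp: sets_restrict_space)
      have "emeasure (P i) ((\<lambda>x. x) -` B \<inter> space (P i)) = emeasure (P i) ((B \<inter> {0<..<1}) \<inter> A i)"
        using A[OF i] by (intro arg_cong[where f = "emeasure (P i)"]) (auto simp: space)
      also have "\<dots> = emeasure ?U (B \<inter> {0<..<1})"
        unfolding P_def using B
        by (intro emeasure_trace_measure[OF sub full]) (auto simp: sets_restrict_space)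
      also have "\<dots> = emeasure lborel (B \<inter> {0<..<1})"
        by (simp add: emeasure_restrict_space)
      also have "\<dots> = emeasure lborel B"
      proof (rule emeasure_eq_AE)
        show "AE x in lborel. x \<in> B \<inter> {0<..<1} \<longleftrightarrow> x \<in> B"
          using AE_lborel_singleton[of 0] AE_lborel_singleton[of 1]
        proof eventually_elim
          case (elim x)
          then show ?case using B(2) by (force simp: less_le)
        qed
      qed (use B in auto)
      finally show "emeasure (P i) ((\<lambda>x. x) -` B \<inter> space (P i)) = emeasure lborel B" .
    qed
    moreover have "h \<circ> (\<lambda>x. x) \<in> borel_measurable (P i)"
      using measurable_trace_measure[OF sub q(1)[OF i]] h
      by (subst measurable_cong[of _ _ "q i"]) (auto simp: space P_def[symmetric])
    moreover have "distr (P i) borel (h \<circ> (\<lambda>x. x)) = distr (P i) borel (q i)"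
      using h by (intro distr_cong) (auto simp: space)
    then have "distr (P i) borel (h \<circ> (\<lambda>x. x)) = \<mu> i"
      using distr_trace_measure[OF sub full q(1)[OF i]] q(2)[OF i] by (simp add: P_def)
    ultimately show ?thesis by blast
  qed
  then show ?thesis
    by (intro exI[of _ P] exI[of _ "\<lambda>_ x. x"] exI[of _ h]) blast
qed

end
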